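(* Let $\mathbb{F}$ be either $\mathbb{R}$ or $\mathbb{C}$, and let $\mathcal{A}$ be a homotonic algebra over $\mathbb{F}$ of $\mathbb{F}$-valued functions defined on a set $\mathbf{T}$, with multiplication $\times$. Let $w$ be a fixed positive function on $\mathbf{T}$ (not necessarily in $\mathcal{A}$) such that the function $w_{-1}$, defined by $w_{-1}(t)=\frac{1}{w(t)}$ for all $t\in\mathbf{T}$, belongs to $\mathcal{A}$. Assume that $$\sup_{t\in\mathbf{T}}w(t)|f(t)|<\infty\quad\text{for all }f\in\mathcal{A}.$$ Then the weighted sup norm $$\Vert f\Vert_{w,\infty}=\sup_{t\in\mathbf{T}}w(t)|f(t)|,\quad f\in\mathcal{A},$$ is strongly stable if and only if $$w_{-1}\times w_{-1}\le w_{-1}.$$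
   Context: An algebra $\mathcal{A}$ over $\mathbb{F}$ ($\mathbb{R}$ or $\mathbb{C}$) of $\mathbb{F}$-valued functions on a set $\mathbf{T}$ means a (finite or infinite dimensional) vector space over $\mathbb{F}$ of functions $\mathbf{T}\to\mathbb{F}$, with pointwise addition and scalar multiplication, equipped with an $\mathbb{F}$-bilinear multiplication $\times:\mathcal{A}\times\mathcal{A}\to\mathcal{A}$. The multiplication need not be pointwise, and is not assumed to be associative, commutative or unital. The functions are not assumed to be bounded. For $f\in\mathcal{A}$, $|f|$ is the function defined by $|f|(t)=|f(t)|$ for $t\in\mathbf{T}$. For real valued functions $f,g$ on $\mathbf{T}$, $f\le g$ means $f(t)\le g(t)$ for all $t\in\mathbf{T}$. (When $\mathbb{F}=\mathbb{C}$, writing an inequality between two functions includes the assertion that both functions are real valued.) $\mathcal{A}$ is called homotonic if: (i) $f\in\mathcal{A}$ implies $|f|\in\mathcal{A}$; and (ii) for any two elements $f,g\in\mathcal{A}$, $|f\times g|\le |f|\times|g|$. Powers of an element $f\in\mathcal{A}$ are defined inductively (whether or not $\mathcal{A}$ is associative) by $f^1=f$ and $f^k=f^{k-1}\times f$ for $k=2,3,4,\dots$. A norm $\Vert\cdot\Vert$ on $\mathcal{A}$ is called strongly stable if $\Vert f^k\Vert\le\Vert f\Vert^k$ for all $f\in\mathcal{A}$ and $k=1,2,3,\dots$. *)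

theory Defs
  imports Complex_Main "HOL-Library.Function_Algebras"
begin

text \<open>
  The scalar field is a type \<open>'k\<close> of class \<open>real_normed_field\<close>, to be instantiated with
  \<open>real\<close> or \<open>complex\<close>; the underlying set of points is a type \<open>'t\<close>.
  Addition, subtraction and zero of functions are the pointwise ones of \<open>Function_Algebras\<close>.
\<close>

definition fun_scale :: "'k::real_normed_field \<Rightarrow> ('t \<Rightarrow> 'k) \<Rightarrow> 't \<Rightarrow> 'k" where
  "fun_scale c f = (\<lambda>t. c * f t)"

interpretation fun_space: vector_space "fun_scale :: 'k::real_normed_field \<Rightarrow> ('t \<Rightarrow> 'k) \<Rightarrow> 't \<Rightarrow> 'k"
  by unfold_locales (auto simp: fun_scale_def fun_eq_iff algebra_simps)

text \<open>
  The multiplication is a total function on \<open>'t \<Rightarrow> 'k\<close>, but only its values on \<open>A\<close> are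
  constrained.  It is unrelated to the pointwise product.
\<close>

locale function_algebra =
  fixes A :: "('t \<Rightarrow> 'k::real_normed_field) set"
    and mult :: "('t \<Rightarrow> 'k) \<Rightarrow> ('t \<Rightarrow> 'k) \<Rightarrow> ('t \<Rightarrow> 'k)" (infixl "\<otimes>" 70)
  assumes subspace: "fun_space.subspace A"
    and mult_closed: "\<lbrakk>f \<in> A; g \<in> A\<rbrakk> \<Longrightarrow> f \<otimes> g \<in> A"
    and add_left: "\<lbrakk>f \<in> A; g \<in> A; h \<in> A\<rbrakk> \<Longrightarrow> (f + g) \<otimes> h = f \<otimes> h + g \<otimes> h"
    and add_right: "\<lbrakk>f \<in> A; g \<in> A; h \<in> A\<rbrakk> \<Longrightarrow> f \<otimes> (g + h) = f \<otimes> g + f \<otimes> h"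
    and scale_left: "\<lbrakk>f \<in> A; g \<in> A\<rbrakk> \<Longrightarrow> fun_scale c f \<otimes> g = fun_scale c (f \<otimes> g)"
    and scale_right: "\<lbrakk>f \<in> A; g \<in> A\<rbrakk> \<Longrightarrow> f \<otimes> fun_scale c g = fun_scale c (f \<otimes> g)"

definition fun_abs :: "('t \<Rightarrow> 'k::real_normed_field) \<Rightarrow> 't \<Rightarrow> 'k" where
  "fun_abs f = (\<lambda>t. of_real (norm (f t)))"

text \<open>An inequality between two functions includes the assertion that both are real valued.\<close>

definition fun_le :: "('t \<Rightarrow> 'k::real_normed_field) \<Rightarrow> ('t \<Rightarrow> 'k) \<Rightarrow> bool" where
  "fun_le f g \<longleftrightarrow> (\<forall>t. \<exists>a b::real. f t = of_real a \<and> g t = of_real b \<and> a \<le> b)"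

locale homotonic_algebra = function_algebra +
  assumes abs_closed: "f \<in> A \<Longrightarrow> fun_abs f \<in> A"
    and abs_mult_le: "\<lbrakk>f \<in> A; g \<in> A\<rbrakk> \<Longrightarrow> fun_le (fun_abs (f \<otimes> g)) (fun_abs f \<otimes> fun_abs g)"

text \<open>Left-normed powers; the exponent \<open>0\<close> is left unspecified, as there need not be a unit.\<close>

fun alg_power :: "('a \<Rightarrow> 'a \<Rightarrow> 'a) \<Rightarrow> 'a \<Rightarrow> nat \<Rightarrow> 'a" where
  "alg_power mult f (Suc 0) = f"
| "alg_power mult f (Suc (Suc k)) = mult (alg_power mult f (Suc k)) f"

definition norm_on :: "('t \<Rightarrow> 'k::real_normed_field) set \<Rightarrow> (('t \<Rightarrow> 'k) \<Rightarrow> real) \<Rightarrow> bool" where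
  "norm_on A N \<longleftrightarrow>
     (\<forall>f\<in>A. 0 \<le> N f \<and> (N f = 0 \<longleftrightarrow> f = 0)) \<and>
     (\<forall>c. \<forall>f\<in>A. N (fun_scale c f) = norm c * N f) \<and>
     (\<forall>f\<in>A. \<forall>g\<in>A. N (f + g) \<le> N f + N g)"

definition strongly_stable ::
    "('t \<Rightarrow> 'k::real_normed_field) set \<Rightarrow> (('t \<Rightarrow> 'k) \<Rightarrow> ('t \<Rightarrow> 'k) \<Rightarrow> ('t \<Rightarrow> 'k))
      \<Rightarrow> (('t \<Rightarrow> 'k) \<Rightarrow> real) \<Rightarrow> bool" where
  "strongly_stable A mult N \<longleftrightarrow>
     norm_on A N \<and> (\<forall>f\<in>A. \<forall>k\<ge>1. N (alg_power mult f k) \<le> N f ^ k)"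

definition recip_weight :: "('t \<Rightarrow> real) \<Rightarrow> 't \<Rightarrow> 'k::real_normed_field" where
  "recip_weight w = (\<lambda>t. of_real (1 / w t))"

text \<open>The supremum is only meaningful when \<open>\<lambda>t. w t * norm (f t)\<close> is bounded above.\<close>

definition weighted_sup_norm :: "('t \<Rightarrow> real) \<Rightarrow> ('t \<Rightarrow> 'k::real_normed_field) \<Rightarrow> real" where
  "weighted_sup_norm w f = (SUP t. w t * norm (f t))"

end

theory Submission
  imports Defs
begin

text \<open>
  Write \<open>u\<close> for the reciprocal weight.  The proof is an order argument.  The weighted norm
  measures functions against multiples of \<open>u\<close>: the norm of \<open>f\<close> is at most \<open>c\<close> exactly if
  \<open>|f| \<le> c u\<close> (lemma \<open>weighted_sup_norm_le_iff\<close>); in particular \<open>u\<close> has norm \<open>1\<close>.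

  The homotonic inequality applied to nonnegative functions, which are their own absolute
  values, makes their product dominate its own absolute value, so this product is nonnegative.
  By bilinearity the multiplication is then monotone on nonnegative functions
  (lemma \<open>mult_mono\<close>).  From \<open>|f| \<le> a u\<close> and \<open>|g| \<le> b u\<close> one gets
  \<open>|f \<times> g| \<le> |f| \<times> |g| \<le> a b (u \<times> u)\<close>.  If \<open>u \<times> u \<le> u\<close>, the norm is therefore submultiplicative
  on all of the algebra, and strong stability follows by induction on the exponent.  In the other
  direction, strong stability for the square of \<open>u\<close> gives \<open>|u \<times> u| \<le> u\<close>, and
  \<open>u \<times> u\<close> is nonnegative.

  The argument runs uniformly over all real normed fields, and the real and complex cases are
  instances of \<open>strongly_stable_weighted_sup_norm_iff\<close>.
\<close>

section \<open>The pointwise order on functions\<close>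

lemma fun_le_trans [trans]:
  assumes "fun_le f g" "fun_le g h"
  shows "fun_le f h"
  unfolding fun_le_def
proof
  fix t
  from assms obtain a b b' c where "f t = of_real a" "g t = of_real b" "a \<le> b"
    "g t = of_real b'" "h t = of_real c" "b' \<le> c"
    unfolding fun_le_def by metis
  moreover from this have "b = b'" by simp
  ultimately show "\<exists>a c. f t = of_real a \<and> h t = of_real c \<and> a \<le> c"
    by (metis order_trans)
qed

lemma fun_le_add:
  assumes "fun_le f g" "fun_le h k"
  shows "fun_le (f + h) (g + k)"
  using assms unfolding fun_le_def plus_fun_def by (metis add_mono of_real_add)

lemma fun_le_diff_nonneg: "fun_le f g \<Longrightarrow> fun_le 0 (g - f)"
  unfolding fun_le_def fun_diff_def zero_fun_def
  by (metis diff_ge_0_iff_ge of_real_diff of_real_0)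

text \<open>
  The relation \<open>fun_le\<close> is reflexive only on real valued functions; nonnegativity is how this
  is guaranteed below.
\<close>

lemma fun_le_refl_of_nonneg: "fun_le 0 f \<Longrightarrow> fun_le f f"
  unfolding fun_le_def by blast

lemma fun_le_scale:
  assumes "fun_le f g" "0 \<le> c"
  shows "fun_le (fun_scale (of_real c) f) (fun_scale (of_real c) g)"
  using assms unfolding fun_le_def fun_scale_def by (metis mult_left_mono of_real_mult)

lemma fun_abs_nonneg: "fun_le 0 (fun_abs f)"
  unfolding fun_le_def fun_abs_def zero_fun_def by (metis norm_ge_zero of_real_0)

lemma fun_abs_of_nonneg:
  fixes f :: "'a \<Rightarrow> 'b::real_normed_field"
  assumes "fun_le 0 f"
  shows "fun_abs f = f"
proof (rule ext)
  fix t
  obtain a b where ab: "(0::'b) = of_real a" "f t = of_real b" "a \<le> b"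
    using assms unfolding fun_le_def zero_fun_def by blast
  then have "0 \<le> b" by (metis of_real_0 of_real_eq_iff)
  then show "fun_abs f t = f t"
    by (simp add: fun_abs_def ab(2))
qed

lemma recip_weight_nonneg:
  assumes "\<And>t. 0 < w t"
  shows "fun_le 0 (recip_weight w :: 't \<Rightarrow> 'k::real_normed_field)"
  unfolding fun_le_def
proof
  fix t
  have "(0::'t \<Rightarrow> 'k) t = of_real 0" "(recip_weight w :: 't \<Rightarrow> 'k) t = of_real (1 / w t)"
    "0 \<le> 1 / w t"
    using assms[of t] by (auto simp: recip_weight_def)
  then show "\<exists>a b. (0::'t \<Rightarrow> 'k) t = of_real a \<and> (recip_weight w :: 't \<Rightarrow> 'k) t = of_real b \<and> a \<le> b"
    by blast
qed

section \<open>Monotonicity of the multiplication\<close>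

text \<open>
  For nonnegative \<open>f\<close> and \<open>g\<close> the homotonic inequality reads \<open>|f \<times> g| \<le> f \<times> g\<close>.
\<close>

lemma (in homotonic_algebra) mult_nonneg:
  assumes "f \<in> A" "g \<in> A" "fun_le 0 f" "fun_le 0 g"
  shows "fun_le 0 (f \<otimes> g)"
  using fun_le_trans[OF fun_abs_nonneg abs_mult_le[OF assms(1,2)]] assms(3,4)
  by (simp add: fun_abs_of_nonneg)

text \<open>
  Here \<open>g \<times> k\<close> is the sum of the nonnegative functions \<open>f \<times> h\<close>, \<open>f \<times> (k - h)\<close> and
  \<open>(g - f) \<times> k\<close>.
\<close>

lemma (in homotonic_algebra) mult_mono:
  assumes A: "f \<in> A" "g \<in> A" "h \<in> A" "k \<in> A"
    and le: "fun_le 0 f" "fun_le f g" "fun_le 0 h" "fun_le h k"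
  shows "fun_le (f \<otimes> h) (g \<otimes> k)"
proof -
  have diff: "k - h \<in> A" "g - f \<in> A"
    using A subspace by (auto intro: fun_space.subspace_diff)
  have k: "fun_le 0 k" using fun_le_trans le by blast
  have pos: "fun_le 0 (f \<otimes> (k - h))" "fun_le 0 ((g - f) \<otimes> k)" "fun_le 0 (f \<otimes> h)"
    using A diff le k by (auto intro: mult_nonneg fun_le_diff_nonneg)
  have "g \<otimes> k = f \<otimes> k + (g - f) \<otimes> k"
    using add_left[OF A(1) diff(2) A(4)] by simp
  also have "f \<otimes> k = f \<otimes> h + f \<otimes> (k - h)"
    using add_right[OF A(1) A(3) diff(1)] by simp
  finally have "g \<otimes> k = f \<otimes> h + f \<otimes> (k - h) + (g - f) \<otimes> k" .
  moreover have "fun_le (f \<otimes> h + 0 + 0) (f \<otimes> h + f \<otimes> (k - h) + (g - f) \<otimes> k)"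
    using pos by (intro fun_le_add fun_le_refl_of_nonneg)
  ultimately show ?thesis by simp
qed

section \<open>The weighted sup norm\<close>

lemma weighted_sup_norm_upper:
  assumes "bdd_above (range (\<lambda>t. w t * norm (f t)))"
  shows "w t * norm (f t) \<le> weighted_sup_norm w f"
  unfolding weighted_sup_norm_def using assms by (rule cSUP_upper[OF UNIV_I])

lemma weighted_sup_norm_least:
  assumes "\<And>t. w t * norm (f t) \<le> c"
  shows "weighted_sup_norm w f \<le> c"
  unfolding weighted_sup_norm_def using assms by (intro cSUP_least) auto

text \<open>
  This turns norm estimates into order relations with multiples of the reciprocal weight,
  where monotonicity of the multiplication can be used.
\<close>

lemma weighted_sup_norm_le_iff:
  fixes f :: "'t \<Rightarrow> 'k::real_normed_field"
  assumes w: "\<And>t. 0 < w t" and bdd: "bdd_above (range (\<lambda>t. w t * norm (f t)))"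
  shows "weighted_sup_norm w f \<le> c \<longleftrightarrow>
    fun_le (fun_abs f) (fun_scale (of_real c) (recip_weight w))"
proof -
  have "weighted_sup_norm w f \<le> c \<longleftrightarrow> (\<forall>t. w t * norm (f t) \<le> c)"
    using weighted_sup_norm_upper[OF bdd] weighted_sup_norm_least[of w f c] order_trans by blast
  also have "\<dots> \<longleftrightarrow> (\<forall>t. norm (f t) \<le> c * (1 / w t))"
    using w by (simp add: field_simps)
  also have "\<dots> \<longleftrightarrow> fun_le (fun_abs f) (fun_scale (of_real c) (recip_weight w))"
    unfolding fun_le_def fun_abs_def fun_scale_def recip_weight_def of_real_mult[symmetric]
    by (metis of_real_eq_iff)
  finally show ?thesis .
qed

lemma weighted_sup_norm_nonneg:
  assumes w: "\<And>t. 0 < w t" and bdd: "bdd_above (range (\<lambda>t. w t * norm (f t)))"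
  shows "0 \<le> weighted_sup_norm w f"
proof -
  have "0 \<le> w undefined * norm (f undefined)"
    using w[of undefined] by simp
  also have "\<dots> \<le> weighted_sup_norm w f" by (rule weighted_sup_norm_upper[OF bdd])
  finally show ?thesis .
qed

lemma weighted_sup_norm_recip_weight:
  assumes "\<And>t. 0 < w t"
  shows "weighted_sup_norm w (recip_weight w :: 't \<Rightarrow> 'k::real_normed_field) = 1"
proof -
  have "w t * norm (recip_weight w t :: 'k) = 1" for t
    using assms[of t] by (simp add: recip_weight_def norm_divide)
  then show ?thesis by (simp add: weighted_sup_norm_def)
qed

lemma weighted_sup_norm_scale_le:
  assumes "bdd_above (range (\<lambda>t. w t * norm (f t)))"
  shows "weighted_sup_norm w (fun_scale c f) \<le> norm c * weighted_sup_norm w f"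
proof (rule weighted_sup_norm_least)
  fix t
  show "w t * norm (fun_scale c f t) \<le> norm c * weighted_sup_norm w f"
    using mult_left_mono[OF weighted_sup_norm_upper[OF assms, of t] norm_ge_zero[of c]]
    by (simp add: fun_scale_def norm_mult mult_ac)
qed

lemma norm_on_weighted_sup_norm:
  fixes A :: "('t \<Rightarrow> 'k::real_normed_field) set"
  assumes w: "\<And>t. 0 < w t" and sub: "fun_space.subspace A"
    and bdd: "\<And>f. f \<in> A \<Longrightarrow> bdd_above (range (\<lambda>t. w t * norm (f t)))"
  shows "norm_on A (weighted_sup_norm w)"
  unfolding norm_on_def
proof (intro conjI ballI allI)
  fix f assume f: "f \<in> A"
  note upper = weighted_sup_norm_upper[OF bdd[OF f]]
  show nonneg: "0 \<le> weighted_sup_norm w f"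
    by (rule weighted_sup_norm_nonneg[OF w bdd[OF f]])
  show "weighted_sup_norm w f = 0 \<longleftrightarrow> f = 0"
  proof
    assume "weighted_sup_norm w f = 0"
    then have "w t * norm (f t) \<le> 0" for t using upper[of t] by simp
    then have "f t = 0" for t using w[of t] by (metis mult_le_0_iff norm_le_zero_iff not_less)
    then show "f = 0" by auto
  qed (simp add: weighted_sup_norm_def)
  show "weighted_sup_norm w (fun_scale c f) = norm c * weighted_sup_norm w f" for c
  proof (cases "c = 0")
    case True
    then show ?thesis by (simp add: weighted_sup_norm_def fun_scale_def)
  next
    case False
    \<comment> \<open>The missing inequality is the other one, applied to \<open>inverse c\<close> and \<open>fun_scale c f\<close>.\<close>
    have cf: "fun_scale c f \<in> A" using sub f by (rule fun_space.subspace_scale)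
    have "fun_scale (inverse c) (fun_scale c f) = f"
      using False by (simp add: fun_scale_def mult.assoc[symmetric])
    then have "weighted_sup_norm w f \<le> norm (inverse c) * weighted_sup_norm w (fun_scale c f)"
      using weighted_sup_norm_scale_le[OF bdd[OF cf], of "inverse c"] by simp
    then have "norm c * weighted_sup_norm w f \<le> weighted_sup_norm w (fun_scale c f)"
      using False by (simp add: norm_inverse norm_divide field_simps)
    then show ?thesis
      using weighted_sup_norm_scale_le[OF bdd[OF f], of c] by simp
  qed
  show "weighted_sup_norm w (f + g) \<le> weighted_sup_norm w f + weighted_sup_norm w g"
    if g: "g \<in> A" for g
  proof (rule weighted_sup_norm_least)
    fix t
    have "w t * norm ((f + g) t) \<le> w t * norm (f t) + w t * norm (g t)"
      using mult_left_mono[OF norm_triangle_ineq[of "f t" "g t"], of "w t"] w[of t]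
      by (simp add: distrib_left)
    also have "\<dots> \<le> weighted_sup_norm w f + weighted_sup_norm w g"
      using upper weighted_sup_norm_upper[OF bdd[OF g]] by (rule add_mono)
    finally show "w t * norm ((f + g) t) \<le> weighted_sup_norm w f + weighted_sup_norm w g" .
  qed
qed

section \<open>Submultiplicativity and strong stability\<close>

text \<open>
  A bound on the single product \<open>u \<times> u\<close> controls all products, because \<open>u\<close> times the norm of \<open>f\<close>
  is a majorant of \<open>|f|\<close> that lies in the algebra and may be inserted in both factors by
  monotonicity.
\<close>

lemma (in homotonic_algebra) weighted_sup_norm_mult_le:
  fixes w :: "'a \<Rightarrow> real"
  assumes w: "\<And>t. 0 < w t" and u: "recip_weight w \<in> A"
    and bdd: "\<And>f. f \<in> A \<Longrightarrow> bdd_above (range (\<lambda>t. w t * norm (f t)))"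
    and le: "fun_le (recip_weight w \<otimes> recip_weight w) (recip_weight w)"
    and f: "f \<in> A" and g: "g \<in> A"
  shows "weighted_sup_norm w (f \<otimes> g) \<le> weighted_sup_norm w f * weighted_sup_norm w g"
proof -
  let ?u = "recip_weight w"
  define a b where "a = weighted_sup_norm w f" and "b = weighted_sup_norm w g"
  have ab: "0 \<le> a" "0 \<le> b"
    unfolding a_def b_def using weighted_sup_norm_nonneg[OF w bdd] f g by auto
  have scaled: "fun_scale c ?u \<in> A" for c
    using subspace u by (rule fun_space.subspace_scale)
  have abs_f: "fun_le (fun_abs f) (fun_scale (of_real a) ?u)"
    and abs_g: "fun_le (fun_abs g) (fun_scale (of_real b) ?u)"
    using weighted_sup_norm_le_iff[OF w bdd] f g a_def b_def by auto
  have "fun_le (fun_abs (f \<otimes> g)) (fun_abs f \<otimes> fun_abs g)"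
    using f g by (rule abs_mult_le)
  also have "fun_le (fun_abs f \<otimes> fun_abs g) (fun_scale (of_real a) ?u \<otimes> fun_scale (of_real b) ?u)"
    using f g abs_f abs_g by (intro mult_mono abs_closed scaled fun_abs_nonneg)
  also have "fun_scale (of_real a) ?u \<otimes> fun_scale (of_real b) ?u
      = fun_scale (of_real (a * b)) (?u \<otimes> ?u)"
    using u scaled by (simp add: scale_left scale_right)
  also have "fun_le \<dots> (fun_scale (of_real (a * b)) ?u)"
    using le ab by (intro fun_le_scale) auto
  finally show ?thesis
    using weighted_sup_norm_le_iff[OF w bdd[OF mult_closed[OF f g]]] a_def b_def by simp
qed

lemma (in function_algebra) alg_power_closed:
  assumes "f \<in> A"
  shows "alg_power (\<otimes>) f (Suc k) \<in> A"
  using assms by (induction k) (auto intro: mult_closed)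

lemma (in homotonic_algebra) strongly_stable_weighted_sup_norm_iff:
  fixes w :: "'a \<Rightarrow> real"
  assumes w: "\<And>t. 0 < w t" and u: "recip_weight w \<in> A"
    and bdd: "\<And>f. f \<in> A \<Longrightarrow> bdd_above (range (\<lambda>t. w t * norm (f t)))"
  shows "strongly_stable A (\<otimes>) (weighted_sup_norm w) \<longleftrightarrow>
    fun_le (recip_weight w \<otimes> recip_weight w) (recip_weight w)"
proof
  let ?u = "recip_weight w :: 'a \<Rightarrow> 'b"
  assume "strongly_stable A (\<otimes>) (weighted_sup_norm w)"
  then have "weighted_sup_norm w (alg_power (\<otimes>) ?u 2) \<le> weighted_sup_norm w ?u ^ 2"
    unfolding strongly_stable_def using u by (metis one_le_numeral)
  then have "weighted_sup_norm w (?u \<otimes> ?u) \<le> 1"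
    using weighted_sup_norm_recip_weight[where 'k = 'b and w = w, OF w] by (simp add: numeral_2_eq_2)
  then have "fun_le (fun_abs (?u \<otimes> ?u)) ?u"
    using weighted_sup_norm_le_iff[OF w bdd[OF mult_closed[OF u u]], of 1] by simp
  then show "fun_le (?u \<otimes> ?u) ?u"
    using mult_nonneg[OF u u] recip_weight_nonneg[where 'k = 'b and w = w, OF w]
    by (simp add: fun_abs_of_nonneg)
next
  let ?N = "weighted_sup_norm w"
  assume le: "fun_le (recip_weight w \<otimes> recip_weight w) (recip_weight w)"
  have power: "?N (alg_power (\<otimes>) f (Suc k)) \<le> ?N f ^ Suc k" if f: "f \<in> A" for f k
  proof (induction k)
    case (Suc k)
    have "?N (alg_power (\<otimes>) f (Suc k) \<otimes> f) \<le> ?N (alg_power (\<otimes>) f (Suc k)) * ?N f"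
      by (rule weighted_sup_norm_mult_le[OF w u bdd le alg_power_closed[OF f] f])
    also have "\<dots> \<le> ?N f ^ Suc k * ?N f"
      by (rule mult_right_mono[OF Suc weighted_sup_norm_nonneg[OF w bdd[OF f]]])
    finally show ?case by (simp add: mult_ac)
  qed simp
  have "?N (alg_power (\<otimes>) f k) \<le> ?N f ^ k" if "f \<in> A" "1 \<le> k" for f k
    using power[of f "k - 1"] that by simp
  then show "strongly_stable A (\<otimes>) ?N"
    unfolding strongly_stable_def
    using norm_on_weighted_sup_norm[OF w subspace bdd] by auto
qed

theorem theorem4p1:
  fixes w :: "'t \<Rightarrow> real"
  assumes w_pos: "\<And>t. 0 < w t"
  shows
    "(\<forall>(A :: ('t \<Rightarrow> real) set) mult.
        homotonic_algebra A mult \<longrightarrow>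
        recip_weight w \<in> A \<longrightarrow>
        (\<forall>f\<in>A. bdd_above (range (\<lambda>t. w t * norm (f t)))) \<longrightarrow>
        (strongly_stable A mult (weighted_sup_norm w) \<longleftrightarrow>
         fun_le (mult (recip_weight w) (recip_weight w)) (recip_weight w)))
     \<and>
     (\<forall>(A :: ('t \<Rightarrow> complex) set) mult.
        homotonic_algebra A mult \<longrightarrow>
        recip_weight w \<in> A \<longrightarrow>
        (\<forall>f\<in>A. bdd_above (range (\<lambda>t. w t * norm (f t)))) \<longrightarrow>
        (strongly_stable A mult (weighted_sup_norm w) \<longleftrightarrow>
         fun_le (mult (recip_weight w) (recip_weight w)) (recip_weight w)))"
  by (intro conjI allI impI; rule homotonic_algebra.strongly_stable_weighted_sup_norm_iff)
     (use w_pos in auto)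

end
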